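(* For all integers $k,d\ge 1$, the randomized query complexity of the gap group testing (GGT) problem with parameters $k$ and $d$ is $\widetilde\Omega\big(\min\{k,\;1+(k/d)^2\}\big)$ (regarded as a function of $k$ and $d$, with the universe size $n$ allowed to be chosen; $\widetilde\Omega$ hides polylogarithmic factors in $k$).
   Context: Let $n\ge 1$ and $[n]=\{1,\dots,n\}$. Let $\mathcal X$ be the family of all subsets of $[n]$ of size exactly $k$ and $\mathcal Y$ the family of all subsets of $[n]$ of size exactly $k+d$. Define $\widetilde{\mathcal X}=\{f:2^{[n]}\to\{0,1\}\mid \exists A\in\mathcal X\ \forall S\subseteq[n]:\ S\cap A=\emptyset\Rightarrow f(S)=0\}$ and $\widetilde{\mathcal Y}=\{f:2^{[n]}\to\{0,1\}\mid \exists B\in\mathcal Y\ \forall S\subseteq[n]:\ S\cap B\neq\emptyset\Rightarrow f(S)=1\}$. In the GGT problem with parameters $k,d$, one is given oracle access to $f\in\widetilde{\mathcal X}\cup\widetilde{\mathcal Y}$ (a query on $S\subseteq[n]$ returns $f(S)$) and must decide whether $f\in\widetilde{\mathcal X}$ or $f\in\widetilde{\mathcal Y}$. The randomized query complexity is the minimum, over randomized algorithms that answer correctly with probability at least $2/3$ on every allowed input, of the worst-case number of queries. *)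

theory Defs
  imports "HOL-Probability.Probability"
begin

datatype 'q query_tree = Answer bool | Query 'q "'q query_tree" "'q query_tree"

primrec run :: "'q query_tree \<Rightarrow> ('q \<Rightarrow> bool) \<Rightarrow> bool" where
  "run (Answer b) f = b"
| "run (Query q t0 t1) f = (if f q then run t1 f else run t0 f)"

primrec num_queries :: "'q query_tree \<Rightarrow> ('q \<Rightarrow> bool) \<Rightarrow> nat" where
  "num_queries (Answer b) f = 0"
| "num_queries (Query q t0 t1) f = Suc (if f q then num_queries t1 f else num_queries t0 f)"

text \<open>
  A randomized algorithm is a probability distribution over deterministic query trees.
  The promise problem is to tell apart \<open>F0\<close> (output \<open>False\<close>) and \<open>F1\<close> (output \<open>True\<close>);
  \<open>set_query_tree t\<close> is the set of queries occurring in \<open>t\<close>, and only queries in \<open>Q\<close> are allowed.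
\<close>

definition solves :: "'q set \<Rightarrow> ('q \<Rightarrow> bool) set \<Rightarrow> ('q \<Rightarrow> bool) set \<Rightarrow> 'q query_tree pmf \<Rightarrow> bool" where
  "solves Q F0 F1 T \<longleftrightarrow>
     (\<forall>t\<in>set_pmf T. set_query_tree t \<subseteq> Q) \<and>
     (\<forall>f\<in>F0. measure_pmf.prob T {t. run t f = False} \<ge> 2 / 3) \<and>
     (\<forall>f\<in>F1. measure_pmf.prob T {t. run t f = True} \<ge> 2 / 3)"

definition makes_at_most ::
    "nat \<Rightarrow> ('q \<Rightarrow> bool) set \<Rightarrow> 'q query_tree pmf \<Rightarrow> bool" where
  "makes_at_most m F T \<longleftrightarrow> (\<forall>f\<in>F. \<forall>t\<in>set_pmf T. num_queries t f \<le> m)"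

definition randomized_query_complexity ::
    "'q set \<Rightarrow> ('q \<Rightarrow> bool) set \<Rightarrow> ('q \<Rightarrow> bool) set \<Rightarrow> nat" where
  "randomized_query_complexity Q F0 F1 =
     (LEAST m. \<exists>T. solves Q F0 F1 T \<and> makes_at_most m (F0 \<union> F1) T)"

definition subsets_of_size :: "nat \<Rightarrow> nat \<Rightarrow> nat set set" where
  "subsets_of_size n s = {A. A \<subseteq> {1..n} \<and> card A = s}"

definition oracles :: "nat \<Rightarrow> (nat set \<Rightarrow> bool) set" where
  "oracles n = (Pow {1..n} \<rightarrow>\<^sub>E UNIV)"

definition ggt_X :: "nat \<Rightarrow> nat \<Rightarrow> (nat set \<Rightarrow> bool) set" where
  "ggt_X n k = {f \<in> oracles n. \<exists>A\<in>subsets_of_size n k.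
     \<forall>S. S \<subseteq> {1..n} \<longrightarrow> S \<inter> A = {} \<longrightarrow> f S = False}"

definition ggt_Y :: "nat \<Rightarrow> nat \<Rightarrow> nat \<Rightarrow> (nat set \<Rightarrow> bool) set" where
  "ggt_Y n k d = {f \<in> oracles n. \<exists>B\<in>subsets_of_size n (k + d).
     \<forall>S. S \<subseteq> {1..n} \<longrightarrow> S \<inter> B \<noteq> {} \<longrightarrow> f S = True}"

definition ggt_complexity :: "nat \<Rightarrow> nat \<Rightarrow> nat \<Rightarrow> nat" where
  "ggt_complexity n k d =
     randomized_query_complexity (Pow {1..n}) (ggt_X n k) (ggt_Y n k d)"

lemma ggt_X_Y_disjoint:
  assumes "d \<ge> 1"
  shows "ggt_X n k \<inter> ggt_Y n k d = {}"
proof (rule ccontr)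
  assume "\<not> ?thesis"
  then obtain f A B where *: "A \<subseteq> {1..n}" "card A = k" "B \<subseteq> {1..n}" "card B = k + d"
    "\<And>S. S \<subseteq> {1..n} \<Longrightarrow> S \<inter> A = {} \<Longrightarrow> \<not> f S"
    "\<And>S. S \<subseteq> {1..n} \<Longrightarrow> S \<inter> B \<noteq> {} \<Longrightarrow> f S"
    unfolding ggt_X_def ggt_Y_def subsets_of_size_def by auto
  have "finite A" using *(1) finite_subset by blast
  then have "\<not> B \<subseteq> A" using card_mono[of A B] *(2,4) assms by auto
  then obtain x where "x \<in> B" "x \<notin> A" by blast
  then show False using *(5)[of "{x}"] *(6)[of "{x}"] *(3) by auto
qed

text \<open>Querying everything solves any promise problem on disjoint sets of functions on a finite
  domain, so the minimum defining the complexity is over a nonempty set.\<close>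

primrec query_all :: "'q list \<Rightarrow> ('q \<Rightarrow> bool) \<Rightarrow> (('q \<Rightarrow> bool) \<Rightarrow> bool) \<Rightarrow> 'q query_tree" where
  "query_all [] g D = Answer (D g)"
| "query_all (q # qs) g D =
     Query q (query_all qs (g(q := False)) D) (query_all qs (g(q := True)) D)"

lemma set_query_all: "set_query_tree (query_all qs g D) \<subseteq> set qs"
proof (induction qs arbitrary: g)
  case (Cons a qs)
  show ?case
    unfolding query_all.simps query_tree.set list.set
    using Cons[of "g(a := False)"] Cons[of "g(a := True)"] by blast
qed simp

lemma num_queries_query_all: "num_queries (query_all qs g D) f = length qs"
  by (induction qs arbitrary: g) auto

lemma run_query_all:
  "run (query_all qs g D) f = D (\<lambda>q. if q \<in> set qs then f q else g q)"
proof (induction qs arbitrary: g)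
  case (Cons a qs)
  have "run (query_all (a # qs) g D) f = run (query_all qs (g(a := f a)) D) f"
    by (cases "f a") (simp_all del: fun_upd_apply only: query_all.simps run.simps if_True if_False)
  also have "\<dots> = D (\<lambda>q. if q \<in> set qs then f q else (g(a := f a)) q)"
    by (rule Cons)
  also have "(\<lambda>q. if q \<in> set qs then f q else (g(a := f a)) q) =
        (\<lambda>q. if q \<in> set (a # qs) then f q else g q)"
    by auto
  finally show ?case .
qed simp

lemma ggt_solvable:
  assumes "d \<ge> 1"
  shows "\<exists>T. solves (Pow {1..n}) (ggt_X n k) (ggt_Y n k d) T \<and>
             makes_at_most (2 ^ n) (ggt_X n k \<union> ggt_Y n k d) T"
proof -
  obtain qs where qs: "set qs = Pow {1..n}" "distinct qs"
    using finite_distinct_list[of "Pow {1..n}"] by auto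
  have len: "length qs = 2 ^ n"
    using distinct_card[OF qs(2)] qs(1) by (simp add: card_Pow)
  define t where "t = query_all qs (\<lambda>_. undefined) (\<lambda>f. f \<in> ggt_Y n k d)"
  have run: "run t f \<longleftrightarrow> f \<in> ggt_Y n k d" if "f \<in> oracles n" for f
  proof -
    have "(\<lambda>q. if q \<in> set qs then f q else undefined) = f"
      using that unfolding oracles_def qs(1) by (auto simp: PiE_def extensional_def)
    then show ?thesis by (simp add: t_def run_query_all)
  qed
  have X: "\<not> run t f" if "f \<in> ggt_X n k" for f
    using that run[of f] ggt_X_Y_disjoint[OF assms, of n k] by (auto simp: ggt_X_def)
  have Y: "run t f" if "f \<in> ggt_Y n k d" for f
    using that run[of f] by (auto simp: ggt_Y_def)
  have "solves (Pow {1..n}) (ggt_X n k) (ggt_Y n k d) (return_pmf t)"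
    unfolding solves_def
  proof (intro conjI ballI)
    show "set_query_tree t' \<subseteq> Pow {1..n}" if "t' \<in> set_pmf (return_pmf t)" for t'
      using that set_query_all[of qs] qs(1) by (simp add: t_def)
  qed (simp_all add: X Y)
  moreover have "makes_at_most (2 ^ n) (ggt_X n k \<union> ggt_Y n k d) (return_pmf t)"
    unfolding makes_at_most_def by (simp add: t_def num_queries_query_all len)
  ultimately show ?thesis by blast
qed

end

theory Submission imports Defs begin

text \<open>
  Hide a random set \<open>H\<close> containing each element of \<open>{1..n}\<close> independently with probability \<open>p\<close>,
  and answer a query \<open>S\<close> by whether \<open>S\<close> meets \<open>H\<close>. This oracle lies in \<open>ggt_X\<close> as soon as
  \<open>card H \<le> k\<close> and in \<open>ggt_Y\<close> as soon as \<open>card H \<ge> k + d\<close>, so by Chebyshev it suffices that the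
  densities \<open>p = (k - D) / n\<close> and \<open>q = (k + 2 D) / n\<close> with \<open>D = max d (6 sqrt k)\<close> are hard to tell apart.
  If the elements of a query are inspected one by one until the first member of \<open>H\<close> shows up,
  one query reveals at most one geometric random variable. Hence \<open>m\<close> queries leave a Bhattacharyya
  affinity of at least \<open>\<rho> ^ m\<close>, where \<open>\<rho> \<ge> 1 - O((D / k)\<^sup>2)\<close> is the affinity of two geometric
  distributions. No logarithmic loss occurs.
\<close>

section \<open>Random subsets with independently chosen elements\<close>

definition bernoulli_mean :: "real \<Rightarrow> 'a set \<Rightarrow> ('a set \<Rightarrow> real) \<Rightarrow> real" where
  "bernoulli_mean p U g = (\<Sum>H\<in>Pow U. p ^ card H * (1 - p) ^ card (U - H) * g H)"

lemma bernoulli_mean_empty [simp]: "bernoulli_mean p {} g = g {}"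
  by (simp add: bernoulli_mean_def)

text \<open>Conditioning on whether the random set contains \<open>x\<close>; this is the step of
  all later inductions over the ground set.\<close>

lemma bernoulli_mean_insert:
  assumes "finite U" "x \<notin> U"
  shows "bernoulli_mean p (insert x U) g =
    (1 - p) * bernoulli_mean p U g + p * bernoulli_mean p U (\<lambda>H. g (insert x H))"
proof -
  have inj: "inj_on (insert x) (Pow U)"
    using assms(2) by (auto simp: inj_on_def)
  have without: "p ^ card H * (1 - p) ^ card (insert x U - H) * g H =
      (1 - p) * (p ^ card H * (1 - p) ^ card (U - H) * g H)" if "H \<in> Pow U" for H
  proof -
    have "insert x U - H = insert x (U - H)" using that assms(2) by auto
    then show ?thesis using assms by simp
  qed
  have "with": "p ^ card (insert x H) * (1 - p) ^ card (insert x U - insert x H) * g (insert x H) =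
      p * (p ^ card H * (1 - p) ^ card (U - H) * g (insert x H))" if "H \<in> Pow U" for H
  proof -
    have "insert x U - insert x H = U - H" "x \<notin> H" "finite H"
      using that assms finite_subset by auto
    then show ?thesis by simp
  qed
  have "bernoulli_mean p (insert x U) g =
      (\<Sum>H\<in>Pow U. p ^ card H * (1 - p) ^ card (insert x U - H) * g H) +
      (\<Sum>H\<in>insert x ` Pow U. p ^ card H * (1 - p) ^ card (insert x U - H) * g H)"
    unfolding bernoulli_mean_def Pow_insert
    using assms by (intro sum.union_disjoint) auto
  also have "\<dots> = (1 - p) * bernoulli_mean p U g + p * bernoulli_mean p U (\<lambda>H. g (insert x H))"
    unfolding bernoulli_mean_def sum_distrib_left sum.reindex[OF inj] o_def
    by (intro arg_cong2[where f = "(+)"] sum.cong refl without "with")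
  finally show ?thesis .
qed

lemma bernoulli_mean_cong:
  "(\<And>H. H \<subseteq> U \<Longrightarrow> g H = h H) \<Longrightarrow> bernoulli_mean p U g = bernoulli_mean p U h"
  unfolding bernoulli_mean_def by (intro sum.cong) auto

lemma bernoulli_mean_mono:
  assumes "0 \<le> p" "p \<le> 1" "\<And>H. H \<subseteq> U \<Longrightarrow> g H \<le> h H"
  shows "bernoulli_mean p U g \<le> bernoulli_mean p U h"
  unfolding bernoulli_mean_def using assms by (intro sum_mono mult_left_mono) auto

lemma bernoulli_mean_const:
  "finite U \<Longrightarrow> bernoulli_mean p U (\<lambda>_. c) = c"
  by (induction U rule: finite_induct) (simp_all add: bernoulli_mean_insert algebra_simps)

lemma bernoulli_mean_add:
  "bernoulli_mean p U (\<lambda>H. g H + h H) = bernoulli_mean p U g + bernoulli_mean p U h"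
  by (simp add: bernoulli_mean_def sum.distrib algebra_simps)

lemma bernoulli_mean_cmult:
  "bernoulli_mean p U (\<lambda>H. c * g H) = c * bernoulli_mean p U g"
  by (simp add: bernoulli_mean_def sum_distrib_left algebra_simps)

lemma bernoulli_mean_bounds:
  assumes "finite U" "0 \<le> p" "p \<le> 1" "\<And>H. 0 \<le> g H" "\<And>H. g H \<le> 1"
  shows "0 \<le> bernoulli_mean p U g" "bernoulli_mean p U g \<le> 1"
  using bernoulli_mean_mono[of p U "\<lambda>_. 0" g] bernoulli_mean_mono[of p U g "\<lambda>_. 1"] assms
  by (auto simp: bernoulli_mean_const)

text \<open>Fubini for a finite sum. It will exchange the choice of the hidden set with the coins of
  the algorithm.\<close>

lemma bernoulli_mean_expectation:
  assumes "finite U" "\<And>H t. \<bar>g t H\<bar> \<le> 1"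
  shows "bernoulli_mean p U (\<lambda>H. measure_pmf.expectation T (\<lambda>t. g t H)) =
    measure_pmf.expectation T (\<lambda>t. bernoulli_mean p U (g t))"
proof -
  have "integrable (measure_pmf T) (\<lambda>t. g t H)" for H
    by (rule measure_pmf.integrable_const_bound[where B = 1]) (use assms(2) in auto)
  then show ?thesis
    unfolding bernoulli_mean_def using assms(1) by (subst Bochner_Integration.integral_sum) auto
qed

text \<open>Binomial variance plus squared bias. The centre \<open>c\<close> is arbitrary because an
  inserted element that belongs to the random set shifts it to \<open>c - 1\<close> in the
  induction.\<close>

lemma bernoulli_mean_card_square:
  fixes p c :: real
  assumes "finite U"
  shows "bernoulli_mean p U (\<lambda>H. (real (card H) - c)\<^sup>2) =
    card U * p * (1 - p) + (card U * p - c)\<^sup>2"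
  using assms
proof (induction U arbitrary: c rule: finite_induct)
  case (insert x U)
  have "bernoulli_mean p U (\<lambda>H. (real (card (insert x H)) - c)\<^sup>2) =
      bernoulli_mean p U (\<lambda>H. (real (card H) - (c - 1))\<^sup>2)"
  proof (rule bernoulli_mean_cong)
    fix H assume "H \<subseteq> U"
    then have "finite H" "x \<notin> H" using insert.hyps finite_subset by auto
    then show "(real (card (insert x H)) - c)\<^sup>2 = (real (card H) - (c - 1))\<^sup>2"
      by (simp add: algebra_simps)
  qed
  then show ?case
    using insert.hyps by (simp add: bernoulli_mean_insert insert.IH) (simp add: algebra_simps power2_eq_square)
qed simp

lemma bernoulli_mean_Chebyshev:
  fixes p L :: real
  assumes "finite U" "0 \<le> p" "p \<le> 1" "0 < L"
    and "\<And>H. E H \<Longrightarrow> L \<le> \<bar>real (card H) - card U * p\<bar>"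
  shows "bernoulli_mean p U (\<lambda>H. of_bool (E H)) \<le> card U * p / L\<^sup>2"
proof -
  have "bernoulli_mean p U (\<lambda>H. of_bool (E H)) \<le>
      bernoulli_mean p U (\<lambda>H. inverse (L\<^sup>2) * (real (card H) - card U * p)\<^sup>2)"
  proof (rule bernoulli_mean_mono)
    fix H
    show "of_bool (E H) \<le> inverse (L\<^sup>2) * (real (card H) - card U * p)\<^sup>2"
    proof (cases "E H")
      case True
      then have "L\<^sup>2 \<le> (real (card H) - card U * p)\<^sup>2"
        using assms(4,5) by (metis abs_le_square_iff abs_of_pos)
      then show ?thesis using True assms(4) by (simp add: field_simps)
    qed simp
  qed (use assms in auto)
  also have "\<dots> = card U * p * (1 - p) / L\<^sup>2"
    unfolding bernoulli_mean_cmult bernoulli_mean_card_square[OF assms(1)]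
    by (simp add: divide_inverse)
  also have "\<dots> \<le> card U * p / L\<^sup>2"
    using assms by (intro divide_right_mono mult_left_le) auto
  finally show ?thesis .
qed

section \<open>Bhattacharyya affinity of two biased bits\<close>

definition affinity :: "real \<Rightarrow> real \<Rightarrow> real" where
  "affinity a b = sqrt (a * b) + sqrt ((1 - a) * (1 - b))"

text \<open>Cauchy-Schwarz for the vectors \<open>(sqrt a, sqrt c)\<close> and
  \<open>(sqrt b, sqrt d)\<close>; after squaring, AM-GM bounds the cross term.\<close>

lemma sqrt_superadditive:
  assumes "0 \<le> a" "0 \<le> b" "0 \<le> c" "0 \<le> (d::real)"
  shows "sqrt (a * b) + sqrt (c * d) \<le> sqrt ((a + c) * (b + d))"
proof (rule real_le_rsqrt)
  have "2 * (sqrt (a * b) * sqrt (c * d)) = 2 * (sqrt (a * d) * sqrt (b * c))"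
    by (simp add: real_sqrt_mult)
  also have "\<dots> \<le> a * d + b * c"
    using assms arith_geo_mean_sqrt[of "a * d" "b * c"] by (simp add: real_sqrt_mult field_simps)
  finally show "(sqrt (a * b) + sqrt (c * d))\<^sup>2 \<le> (a + c) * (b + d)"
    using assms by (simp add: power2_sum algebra_simps)
qed

text \<open>Data processing: the left side is the affinity of the output together with the mixing
  bit, of bias \<open>p\<close> against \<open>q\<close>. Forgetting that bit cannot decrease
  affinity.\<close>

lemma affinity_mixture:
  assumes "0 \<le> p" "p \<le> 1" "0 \<le> q" "q \<le> 1"
    and "0 \<le> a0" "a0 \<le> 1" "0 \<le> a1" "a1 \<le> 1" "0 \<le> b0" "b0 \<le> 1" "0 \<le> b1" "b1 \<le> 1"
  shows "sqrt ((1 - p) * (1 - q)) * affinity a0 b0 + sqrt (p * q) * affinity a1 b1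
    \<le> affinity ((1 - p) * a0 + p * a1) ((1 - q) * b0 + q * b1)"
proof -
  have compl: "1 - ((1 - s) * u + s * v) = (1 - s) * (1 - u) + s * (1 - v)" for s u v :: real
    by algebra
  have regroup: "sqrt ((s * u) * (t * v)) = sqrt (s * t) * sqrt (u * v)" for s t u v :: real
    by (simp add: real_sqrt_mult)
  have "sqrt (((1 - p) * a0) * ((1 - q) * b0)) + sqrt ((p * a1) * (q * b1)) \<le>
      sqrt (((1 - p) * a0 + p * a1) * ((1 - q) * b0 + q * b1))"
    using assms by (intro sqrt_superadditive) auto
  moreover have "sqrt (((1 - p) * (1 - a0)) * ((1 - q) * (1 - b0))) +
      sqrt ((p * (1 - a1)) * (q * (1 - b1))) \<le>
      sqrt (((1 - p) * (1 - a0) + p * (1 - a1)) * ((1 - q) * (1 - b0) + q * (1 - b1)))"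
    using assms by (intro sqrt_superadditive) auto
  ultimately show ?thesis
    unfolding affinity_def compl regroup by (simp only: distrib_left)
qed

lemma affinity_self:
  "0 \<le> a \<Longrightarrow> a \<le> 1 \<Longrightarrow> affinity a a = 1"
  by (simp add: affinity_def)

text \<open>The two sides differ by exactly the square of
  \<open>sqrt (a * (1 - a)) - sqrt (b * (1 - b))\<close>.\<close>

lemma square_diff_le_affinity:
  assumes "0 \<le> a" "a \<le> 1" "0 \<le> b" "b \<le> 1"
  shows "(a - b)\<^sup>2 \<le> 1 - (affinity a b)\<^sup>2"
proof -
  have "(sqrt (a * (1 - a)) - sqrt (b * (1 - b)))\<^sup>2 =
      a * (1 - a) + b * (1 - b) - 2 * (sqrt (a * b) * sqrt ((1 - a) * (1 - b)))"
    using assms by (simp add: power2_diff real_sqrt_mult power_mult_distrib)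
  also have "\<dots> = 1 - (affinity a b)\<^sup>2 - (a - b)\<^sup>2"
    using assms unfolding affinity_def
    by (simp add: power2_sum) (simp add: power2_eq_square algebra_simps)
  finally show ?thesis by (metis diff_ge_0_iff_ge zero_le_power2)
qed

section \<open>Trees cut off at a query bound\<close>

text \<open>
  The query bound holds only for oracles satisfying the promise, but the size of the random hidden
  set may fall strictly between \<open>k\<close> and \<open>k + d\<close>; truncation enforces the bound there as well.
\<close>

primrec truncate_tree :: "'q query_tree \<Rightarrow> nat \<Rightarrow> 'q query_tree" where
  "truncate_tree (Answer b) m = Answer b"
| "truncate_tree (Query q t0 t1) m =
     (case m of 0 \<Rightarrow> Answer False | Suc m' \<Rightarrow> Query q (truncate_tree t0 m') (truncate_tree t1 m'))"

lemma run_truncate: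
  "num_queries t f \<le> m \<Longrightarrow> run (truncate_tree t m) f = run t f"
  by (induction t arbitrary: m) (auto split: nat.splits if_splits)

lemma run_cong:
  "(\<And>q. q \<in> set_query_tree t \<Longrightarrow> f q = g q) \<Longrightarrow> run t f = run t g"
  by (induction t) auto

section \<open>Affinity lost per query\<close>

definition meets :: "'a set \<Rightarrow> 'a set \<Rightarrow> bool" where
  "meets H S \<longleftrightarrow> S \<inter> H \<noteq> {}"

text \<open>The sum of \<open>sqrt (p * (1 - p) ^ i * (q * (1 - q) ^ i))\<close> over \<open>i\<close>.\<close>

definition geometric_affinity :: "real \<Rightarrow> real \<Rightarrow> real" where
  "geometric_affinity p q = sqrt (p * q) / (1 - sqrt ((1 - p) * (1 - q)))"

text \<open>The third claim is the recursion of the geometric series: the first trial fails under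
  both parameters and the series starts afresh, or it succeeds.\<close>

lemma geometric_affinity_le_1:
  assumes "0 < p" "p < 1" "0 < q" "q < 1"
  shows "0 < geometric_affinity p q" "geometric_affinity p q \<le> 1"
    "sqrt ((1 - p) * (1 - q)) * geometric_affinity p q + sqrt (p * q) = geometric_affinity p q"
proof -
  have *: "sqrt (p * q) + sqrt ((1 - p) * (1 - q)) \<le> 1"
    using sqrt_superadditive[of p q "1 - p" "1 - q"] assms by simp
  moreover have "0 < sqrt (p * q)" using assms by simp
  ultimately have r: "0 < 1 - sqrt ((1 - p) * (1 - q))" by linarith
  then show "0 < geometric_affinity p q" "geometric_affinity p q \<le> 1"
    using * assms by (auto simp: geometric_affinity_def)
  show "sqrt ((1 - p) * (1 - q)) * geometric_affinity p q + sqrt (p * q) = geometric_affinity p q"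
    using r unfolding geometric_affinity_def by (simp add: field_simps)
qed

abbreviation accept_prob :: "real \<Rightarrow> 'a set \<Rightarrow> 'a set \<Rightarrow> 'a set query_tree \<Rightarrow> real" where
  "accept_prob p U K t \<equiv> bernoulli_mean p U (\<lambda>H. of_bool (run t (meets (K \<union> H))))"

text \<open>
  \<open>K\<close> collects the members of \<open>H\<close> found so far and \<open>U\<close> the uninspected elements; all others are
  known not to be in \<open>H\<close>. The inner induction inspects the elements of \<open>S \<inter> U\<close> one at a time.
\<close>

lemma affinity_accept_prob:
  assumes pq: "0 < p" "p < 1" "0 < q" "q < 1" and "finite U"
  shows "geometric_affinity p q ^ m \<le>
    affinity (accept_prob p U K (truncate_tree t m)) (accept_prob q U K (truncate_tree t m))"
  using assms(5)
proof (induction t arbitrary: m U K)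
  case (Answer b)
  then show ?case
    using geometric_affinity_le_1[OF pq]
    by (simp add: bernoulli_mean_const affinity_self power_le_one)
next
  case (Query S t0 t1)
  let ?\<rho> = "geometric_affinity p q"
  note \<rho> = geometric_affinity_le_1[OF pq]
  show ?case
  proof (cases m)
    case 0
    then show ?thesis using Query.prems by (simp add: bernoulli_mean_const affinity_self)
  next
    case (Suc m')
    let ?t = "Query S (truncate_tree t0 m') (truncate_tree t1 m')"
    have "?\<rho> ^ Suc m' \<le> affinity (accept_prob p U K ?t) (accept_prob q U K ?t)"
    proof (cases "S \<inter> K = {}")
      case False
      \<comment> \<open>The answer is already known to be yes, so nothing is revealed and a factor
        \<open>?\<rho> \<le> 1\<close> is given away.\<close>
      then have "run ?t (meets (K \<union> H)) = run (truncate_tree t1 m') (meets (K \<union> H))" for H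
        by (auto simp: meets_def)
      moreover have "?\<rho> ^ Suc m' \<le> ?\<rho> ^ m'" using \<rho> by (intro power_decreasing) auto
      ultimately show ?thesis
        using Query.IH(2)[OF Query.prems, of m' K] by simp
    next
      case True
      have "card (S \<inter> U) = j \<Longrightarrow>
        ?\<rho> ^ Suc m' \<le> affinity (accept_prob p U K ?t) (accept_prob q U K ?t)" for j
        using Query.prems
      proof (induction j arbitrary: U)
        case 0
        \<comment> \<open>All of \<open>S\<close> has been ruled out, so the answer is no.\<close>
        then have "S \<inter> U = {}" by simp
        then have "accept_prob s U K ?t = accept_prob s U K (truncate_tree t0 m')" for s
          using True by (intro bernoulli_mean_cong) (auto simp: meets_def)
        moreover have "?\<rho> ^ Suc m' \<le> ?\<rho> ^ m'" using \<rho> by (intro power_decreasing) auto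
        ultimately show ?case
          using Query.IH(1)[OF 0(2), of m' K] by simp
      next
        case (Suc j)
        then obtain x where x: "x \<in> S" "x \<in> U" by (metis Int_iff card_eq_0_iff equals0I nat.distinct(1))
        define V where "V = U - {x}"
        have U: "U = insert x V" "x \<notin> V" "finite V" using x Suc.prems by (auto simp: V_def)
        have "S \<inter> V = S \<inter> U - {x}" by (auto simp: V_def)
        then have "card (S \<inter> V) = j" using Suc.prems x by simp
        note miss = Suc.IH[OF this U(3)]
        \<comment> \<open>Finding \<open>x\<close> settles the query; the rest of \<open>S\<close>
          stays uninspected in \<open>V\<close>.\<close>
        have hit: "run ?t (meets (K \<union> insert x H)) = run (truncate_tree t1 m') (meets (insert x K \<union> H))" for H
          using x by (auto simp: meets_def)
        have split: "accept_prob s U K ?t =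
            (1 - s) * accept_prob s V K ?t + s * accept_prob s V (insert x K) (truncate_tree t1 m')" for s
          unfolding U(1) bernoulli_mean_insert[OF U(3,2)] hit ..
        have bounds: "0 \<le> accept_prob s V L u" "accept_prob s V L u \<le> 1"
          if "0 < s" "s < 1" for s L u
          using that U(3) by (auto intro!: bernoulli_mean_bounds)
        \<comment> \<open>A miss leaves the query open and keeps the exponent \<open>Suc m'\<close>;
          a hit completes it and leaves \<open>m'\<close>. The recursion for \<open>?\<rho>\<close>
          balances the two.\<close>
        have "?\<rho> ^ Suc m' = (sqrt ((1 - p) * (1 - q)) * ?\<rho> + sqrt (p * q)) * ?\<rho> ^ m'"
          using \<rho>(3) by simp
        also have "\<dots> = sqrt ((1 - p) * (1 - q)) * ?\<rho> ^ Suc m' + sqrt (p * q) * ?\<rho> ^ m'"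
          by (simp add: algebra_simps)
        also have "\<dots> \<le> sqrt ((1 - p) * (1 - q)) * affinity (accept_prob p V K ?t) (accept_prob q V K ?t)
            + sqrt (p * q) * affinity (accept_prob p V (insert x K) (truncate_tree t1 m'))
                (accept_prob q V (insert x K) (truncate_tree t1 m'))"
          using miss Query.IH(2)[OF U(3), of m' "insert x K"] pq
          by (intro add_mono mult_left_mono) auto
        also have "\<dots> \<le> affinity (accept_prob p U K ?t) (accept_prob q U K ?t)"
          unfolding split using pq by (intro affinity_mixture bounds) auto
        finally show ?case .
      qed
      then show ?thesis by blast
    qed
    then show ?thesis using Suc by simp
  qed
qed

text \<open>With mean \<open>u\<close> and squared half-difference \<open>e\<close>, both roots have
  the form \<open>sqrt (v\<^sup>2 - e) \<ge> v - e / v\<close>. As \<open>u \<le> 1 / 2\<close>, the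
  correction at \<open>1 - u\<close> is at most \<open>e / u\<close>, so the quotient is at least
  \<open>(u - e / u) / (u + e / u) \<ge> 1 - 2 * e / u\<^sup>2\<close>.\<close>

lemma geometric_affinity_lower_bound:
  assumes "0 < p" "p < 1" "0 < q" "q < 1" "p + q \<le> 1"
  shows "1 - 2 * ((q - p) / (p + q))\<^sup>2 \<le> geometric_affinity p q"
proof -
  let ?r = "sqrt ((1 - p) * (1 - q))"
  define u where "u = (p + q) / 2"
  define e where "e = ((q - p) / 2)\<^sup>2"
  have u: "0 < u" "u \<le> 1 / 2" using assms by (auto simp: u_def)
  have e0: "0 \<le> e" by (simp add: e_def)
  have pq: "p * q = u\<^sup>2 - e" and rr: "(1 - p) * (1 - q) = (1 - u)\<^sup>2 - e"
    unfolding u_def e_def by (simp_all add: field_simps power2_eq_square)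
  have eu: "e < u\<^sup>2" using pq assms by (smt (verit) mult_pos_pos)
  have aux: "v - e / v \<le> sqrt (v\<^sup>2 - e)" if "0 < v" "e \<le> v\<^sup>2" for v
  proof (rule real_le_rsqrt)
    have "(v - e / v)\<^sup>2 = v\<^sup>2 - e - e * (v\<^sup>2 - e) / v\<^sup>2"
      using that by (simp add: field_simps power2_eq_square)
    moreover have "0 \<le> e * (v\<^sup>2 - e) / v\<^sup>2" using that e0 by simp
    ultimately show "(v - e / v)\<^sup>2 \<le> v\<^sup>2 - e" by linarith
  qed
  have "u\<^sup>2 \<le> (1 - u)\<^sup>2" using u by (intro power_mono) auto
  then have "(1 - u) - e / (1 - u) \<le> ?r" unfolding rr using u eu by (intro aux) linarith+
  moreover have "e / (1 - u) \<le> e / u" using u e0 by (intro divide_left_mono) auto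
  ultimately have r: "1 - ?r \<le> u + e / u" by linarith
  have s: "u - e / u \<le> sqrt (p * q)" unfolding pq using u eu by (intro aux) auto
  have r0: "0 < 1 - ?r"
    using assms mult_strict_mono[of "1 - p" 1 "1 - q" 1] by simp
  have eq: "2 * ((q - p) / (p + q))\<^sup>2 = 2 * (e / u\<^sup>2)"
    by (simp add: e_def u_def power_divide)
  have "(1 - 2 * (e / u\<^sup>2)) * (1 - ?r) \<le> sqrt (p * q)"
  \<comment> \<open>Multiplying by the upper bound on \<open>1 - ?r\<close> needs a nonnegative
    factor; a negative one makes the claim trivial.\<close>
  proof (cases "0 \<le> 1 - 2 * (e / u\<^sup>2)")
    case True
    then have "(1 - 2 * (e / u\<^sup>2)) * (1 - ?r) \<le> (1 - 2 * (e / u\<^sup>2)) * (u + e / u)"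
      using r by (intro mult_left_mono) auto
    also have "\<dots> = u - e / u - 2 * (e / u\<^sup>2) * (e / u)"
      using u by (simp add: field_simps power2_eq_square)
    also have "\<dots> \<le> u - e / u" using u e0 by simp
    finally show ?thesis using s by linarith
  next
    case False
    then have "(1 - 2 * (e / u\<^sup>2)) * (1 - ?r) \<le> 0"
      using r0 by (intro mult_nonpos_nonneg) auto
    also have "0 \<le> sqrt (p * q)" using assms by simp
    finally show ?thesis .
  qed
  then show ?thesis unfolding geometric_affinity_def eq using r0 by (simp add: pos_le_divide_eq)
qed

text \<open>Affinity enters squared, so Bernoulli's inequality is applied to the power
  \<open>2 * m\<close>.\<close>

lemma accept_prob_diff:
  assumes "0 < p" "p < 1" "0 < q" "q < 1" "p + q \<le> 1" "finite U"
    and "2 * ((q - p) / (p + q))\<^sup>2 \<le> \<epsilon>"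
  shows "(accept_prob p U K (truncate_tree t m) - accept_prob q U K (truncate_tree t m))\<^sup>2 \<le> 2 * real m * \<epsilon>"
proof -
  let ?\<rho> = "geometric_affinity p q"
  note \<rho> = geometric_affinity_le_1[OF assms(1-4)]
  have "1 - 2 * real m * \<epsilon> \<le> 1 + real (2 * m) * (?\<rho> - 1)"
    using mult_left_mono[of "1 - \<epsilon>" ?\<rho> "real (2 * m)"] geometric_affinity_lower_bound[OF assms(1-5)] assms(7)
    by (simp add: algebra_simps)
  also have "\<dots> \<le> ?\<rho> ^ (2 * m)"
    using Bernoulli_inequality[of "?\<rho> - 1" "2 * m"] \<rho> by simp
  also have "\<dots> = (?\<rho> ^ m)\<^sup>2" by (simp add: power_mult power2_eq_square power_mult_distrib)
  also have "\<dots> \<le> (affinity (accept_prob p U K (truncate_tree t m)) (accept_prob q U K (truncate_tree t m)))\<^sup>2"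
    using \<rho> affinity_accept_prob[OF assms(1-4,6)] by (intro power_mono) auto
  finally have "1 - 2 * real m * \<epsilon> \<le> (affinity (accept_prob p U K (truncate_tree t m)) (accept_prob q U K (truncate_tree t m)))\<^sup>2" .
  moreover have "(accept_prob p U K (truncate_tree t m) - accept_prob q U K (truncate_tree t m))\<^sup>2 \<le>
      1 - (affinity (accept_prob p U K (truncate_tree t m)) (accept_prob q U K (truncate_tree t m)))\<^sup>2"
    using assms(1-4,6) by (intro square_diff_le_affinity bernoulli_mean_bounds) auto
  ultimately show ?thesis by linarith
qed

section \<open>Hidden sets as promise inputs\<close>

text \<open>Members of \<open>oracles n\<close> are extensional, hence the restriction.\<close>

definition hit_oracle :: "nat \<Rightarrow> nat set \<Rightarrow> nat set \<Rightarrow> bool" where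
  "hit_oracle n H = restrict (meets H) (Pow {1..n})"

lemma hit_oracle_in_oracles: "hit_oracle n H \<in> oracles n"
  by (simp add: hit_oracle_def oracles_def)

text \<open>Enlarging \<open>H\<close> to size \<open>k\<close> gives the witness \<open>A\<close>:
  what avoids \<open>A\<close> avoids \<open>H\<close>. For \<open>ggt_Y\<close> the set is shrunk
  instead.\<close>

lemma hit_oracle_in_ggt_X:
  assumes "H \<subseteq> {1..n}" "card H \<le> k" "k \<le> n"
  shows "hit_oracle n H \<in> ggt_X n k"
proof -
  obtain A where "H \<subseteq> A" "A \<subseteq> {1..n}" "card A = k"
    using exists_subset_between[of H k "{1..n}"] assms by auto
  moreover from this have "\<forall>S. S \<subseteq> {1..n} \<longrightarrow> S \<inter> A = {} \<longrightarrow> hit_oracle n H S = False"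
    by (auto simp: hit_oracle_def meets_def)
  ultimately show ?thesis
    using hit_oracle_in_oracles unfolding ggt_X_def subsets_of_size_def by blast
qed

lemma hit_oracle_in_ggt_Y:
  assumes "H \<subseteq> {1..n}" "k + d \<le> card H"
  shows "hit_oracle n H \<in> ggt_Y n k d"
proof -
  obtain B where "B \<subseteq> H" "card B = k + d"
    using obtain_subset_with_card_n[OF assms(2)] by metis
  moreover from this have "\<forall>S. S \<subseteq> {1..n} \<longrightarrow> S \<inter> B \<noteq> {} \<longrightarrow> hit_oracle n H S = True"
    by (auto simp: hit_oracle_def meets_def)
  moreover have "B \<subseteq> {1..n}" using \<open>B \<subseteq> H\<close> assms(1) by blast
  ultimately show ?thesis
    using hit_oracle_in_oracles unfolding ggt_Y_def subsets_of_size_def by blast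
qed

text \<open>A \<open>LEAST\<close> value has its property only if some value does; querying
  everything supplies one.\<close>

lemma ggt_complexity_attained:
  assumes "d \<ge> 1"
  obtains T where "solves (Pow {1..n}) (ggt_X n k) (ggt_Y n k d) T"
    "makes_at_most (ggt_complexity n k d) (ggt_X n k \<union> ggt_Y n k d) T"
  using LeastI_ex[of "\<lambda>m. \<exists>T. solves (Pow {1..n}) (ggt_X n k) (ggt_Y n k d) T \<and>
      makes_at_most m (ggt_X n k \<union> ggt_Y n k d) T"] ggt_solvable[OF assms, of n k] that
  unfolding ggt_complexity_def randomized_query_complexity_def by blast

text \<open>On promise inputs no run reaches the cut, and legal queries cannot distinguish
  \<open>meets H\<close> from its restriction.\<close>

lemma prob_truncate:
  assumes "solves (Pow {1..n}) (ggt_X n k) (ggt_Y n k d) T"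
    and "makes_at_most m (ggt_X n k \<union> ggt_Y n k d) T"
    and "hit_oracle n H \<in> ggt_X n k \<union> ggt_Y n k d"
  shows "measure_pmf.prob T {t. run (truncate_tree t m) (meets H)} =
    measure_pmf.prob T {t. run t (hit_oracle n H)}"
proof (rule measure_pmf.finite_measure_eq_AE)
  show "AE t in measure_pmf T. (t \<in> {t. run (truncate_tree t m) (meets H)}) = (t \<in> {t. run t (hit_oracle n H)})"
  proof (rule AE_pmfI)
    fix t assume t: "t \<in> set_pmf T"
    have set_truncate: "set_query_tree (truncate_tree t m) \<subseteq> set_query_tree t" for t :: "nat set query_tree" and m
      by (induction t arbitrary: m) (fastforce split: nat.splits)+
    have "run (truncate_tree t m) (meets H) = run (truncate_tree t m) (hit_oracle n H)"
      using set_truncate[of t m] assms(1) t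
      by (intro run_cong) (auto simp: hit_oracle_def solves_def)
    also have "\<dots> = run t (hit_oracle n H)"
      using assms(2,3) t by (intro run_truncate) (auto simp: makes_at_most_def)
    finally show "(t \<in> {t. run (truncate_tree t m) (meets H)}) = (t \<in> {t. run t (hit_oracle n H)})" by simp
  qed
qed auto

lemma prob_truncate_X:
  assumes "solves (Pow {1..n}) (ggt_X n k) (ggt_Y n k d) T"
    and "makes_at_most m (ggt_X n k \<union> ggt_Y n k d) T"
    and "H \<subseteq> {1..n}" "card H \<le> k" "k \<le> n"
  shows "measure_pmf.prob T {t. run (truncate_tree t m) (meets H)} \<le> 1 / 3"
proof -
  have X: "hit_oracle n H \<in> ggt_X n k" using assms(3-5) by (rule hit_oracle_in_ggt_X)
  have "measure_pmf.prob T {t. run t (hit_oracle n H) = False} =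
      1 - measure_pmf.prob T {t. run t (hit_oracle n H)}"
    using measure_pmf.prob_compl[of "{t. run t (hit_oracle n H)}" T]
    by (simp add: Compl_eq_Diff_UNIV[symmetric] Collect_neg_eq[symmetric])
  then show ?thesis
    using prob_truncate[OF assms(1,2)] X assms(1) unfolding solves_def by fastforce
qed

lemma prob_truncate_Y:
  assumes "solves (Pow {1..n}) (ggt_X n k) (ggt_Y n k d) T"
    and "makes_at_most m (ggt_X n k \<union> ggt_Y n k d) T"
    and "H \<subseteq> {1..n}" "k + d \<le> card H"
  shows "2 / 3 \<le> measure_pmf.prob T {t. run (truncate_tree t m) (meets H)}"
proof -
  have Y: "hit_oracle n H \<in> ggt_Y n k d" using assms(3-4) by (rule hit_oracle_in_ggt_Y)
  then show ?thesis
    using prob_truncate[OF assms(1,2)] assms(1) unfolding solves_def by fastforce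
qed

section \<open>Lower bounds for fixed parameters\<close>

text \<open>Without queries the output ignores the input. This covers the parameters where the
  target is bounded by a constant.\<close>

lemma ggt_complexity_pos:
  assumes "d \<ge> 1" "k + d \<le> n"
  shows "1 \<le> ggt_complexity n k d"
proof (rule ccontr)
  assume "\<not> ?thesis"
  then obtain T where T: "solves (Pow {1..n}) (ggt_X n k) (ggt_Y n k d) T"
    "makes_at_most 0 (ggt_X n k \<union> ggt_Y n k d) T"
    using ggt_complexity_attained[OF assms(1), of n k] by (auto simp: not_le)
  have "run (truncate_tree t 0) f = run (truncate_tree t 0) g" for t :: "nat set query_tree" and f g
    by (cases t) auto
  then have "{t. run (truncate_tree t 0) (meets {1..k})} = {t. run (truncate_tree t 0) (meets {1..k + d})}" by blast
  with prob_truncate_X[OF T, of "{1..k}"] prob_truncate_Y[OF T, of "{1..k + d}"] assms(2) show False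
    by auto
qed

lemma ggt_complexity_lower_bound:
  assumes "k \<ge> 1" "d \<ge> 1" "real d \<le> D" "6 * sqrt k \<le> D" "D \<le> k / 2" "4 * (k + d) \<le> n"
  shows "(real k)\<^sup>2 / (1000 * D\<^sup>2) \<le> ggt_complexity n k d"
proof (rule ccontr)
  define m where "m = ggt_complexity n k d"
  assume "\<not> ?thesis"
  then have small: "m < (real k)\<^sup>2 / (1000 * D\<^sup>2)" by (simp add: m_def)
  obtain T where T: "solves (Pow {1..n}) (ggt_X n k) (ggt_Y n k d) T"
    "makes_at_most m (ggt_X n k \<union> ggt_Y n k d) T"
    using ggt_complexity_attained[OF assms(2)] unfolding m_def by blast
  \<comment> \<open>The mean sizes \<open>k - D\<close> and \<open>k + 2 * D\<close> lie at least
    \<open>D\<close> away from the thresholds \<open>k\<close> and \<open>k + d\<close>, as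
    \<open>d \<le> D\<close>.\<close>
  define p where "p = (k - D) / n"
  define q where "q = (k + 2 * D) / n"
  let ?U = "{1..n}"
  have D0: "0 < D" using assms by linarith
  have "4 * k \<le> n" "0 < n" using assms by auto
  then have n: "4 * real k \<le> n" "0 < n" by simp_all
  have np: "real n * p = k - D" and nq: "real n * q = k + 2 * D" using n by (auto simp: p_def q_def)
  have pq_sum: "p + q = (2 * k + D) / n" and pq_diff: "q - p = 3 * D / n"
    by (simp_all add: p_def q_def add_divide_distrib[symmetric] diff_divide_distrib[symmetric])
  have pq: "0 < p" "p < 1" "0 < q" "q < 1" "p + q \<le> 1"
    unfolding pq_sum using n D0 assms by (auto simp: p_def q_def field_simps)
  have kD: "36 * k \<le> D\<^sup>2"
    using power_mono[OF assms(4), of 2] by (simp add: power_mult_distrib)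
  have rel: "(q - p) / (p + q) = 3 * D / (2 * k + D)"
    using n by (simp add: pq_sum pq_diff)
  have "3 * D / (2 * k + D) \<le> 3 * D / (2 * k)"
    using D0 assms(1) by (intro divide_left_mono) auto
  then have "(3 * D / (2 * k + D))\<^sup>2 \<le> (3 * D / (2 * k))\<^sup>2"
    using D0 by (intro power_mono) auto
  then have \<epsilon>: "2 * ((q - p) / (p + q))\<^sup>2 \<le> 9 / 2 * D\<^sup>2 / (real k)\<^sup>2"
    unfolding rel by (simp add: power_divide power_mult_distrib)
  define P where "P H = measure_pmf.prob T {t. run (truncate_tree t m) (meets H)}" for H
  have P01: "0 \<le> P H" "P H \<le> 1" for H by (auto simp: P_def)
  \<comment> \<open>Exchanging the averages reduces the comparison to one deterministic tree at a
    time.\<close>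
  have P_mean: "bernoulli_mean s ?U P =
      measure_pmf.expectation T (\<lambda>t. accept_prob s ?U {} (truncate_tree t m))" for s
  proof -
    have "P H = measure_pmf.expectation T (\<lambda>t. of_bool (run (truncate_tree t m) (meets H)))" for H
    proof -
      have "(\<lambda>t. of_bool (run (truncate_tree t m) (meets H)) :: real) = indicator {t. run (truncate_tree t m) (meets H)}"
        by (auto simp: indicator_def)
      then show ?thesis by (simp add: P_def)
    qed
    then have "P = (\<lambda>H. measure_pmf.expectation T (\<lambda>t. of_bool (run (truncate_tree t m) (meets H))))" ..
    then show ?thesis
      by (simp add: bernoulli_mean_expectation)
  qed
  \<comment> \<open>A gap of \<open>1 / 9\<close> needs
    \<open>2 * m * (9 / 2) * D\<^sup>2 / k\<^sup>2 \<le> 1 / 81\<close>, and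
    \<open>9 * 81 = 729\<close>.\<close>
  have "1000 * (real m * D\<^sup>2) < (real k)\<^sup>2" using small D0 by (simp add: field_simps)
  moreover have "0 \<le> real m * D\<^sup>2" by simp
  ultimately have mD: "729 * (real m * D\<^sup>2) \<le> (real k)\<^sup>2" by linarith
  have diff: "accept_prob q ?U {} (truncate_tree t m) \<le> accept_prob p ?U {} (truncate_tree t m) + 1 / 9" for t
  proof -
    have "(accept_prob p ?U {} (truncate_tree t m) - accept_prob q ?U {} (truncate_tree t m))\<^sup>2 \<le>
        2 * real m * (9 / 2 * D\<^sup>2 / (real k)\<^sup>2)"
      by (rule accept_prob_diff[OF pq _ \<epsilon>]) simp
    also have "\<dots> \<le> (1 / 9)\<^sup>2"
      using mD assms(1) by (simp add: field_simps)
    finally show ?thesis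
      unfolding abs_le_square_iff[symmetric] by linarith
  qed
  have int: "integrable (measure_pmf T) (\<lambda>t. accept_prob s ?U {} (truncate_tree t m))" if "0 < s" "s < 1" for s
  proof (rule measure_pmf.integrable_const_bound[where B = 1])
    have "0 \<le> accept_prob s ?U {} (truncate_tree t m)" "accept_prob s ?U {} (truncate_tree t m) \<le> 1" for t
      using that by (auto intro!: bernoulli_mean_bounds)
    then show "AE t in measure_pmf T. norm (accept_prob s ?U {} (truncate_tree t m)) \<le> 1" by simp
  qed simp
  have "bernoulli_mean q ?U P \<le> measure_pmf.expectation T (\<lambda>t. accept_prob p ?U {} (truncate_tree t m) + 1 / 9)"
    unfolding P_mean using int pq diff by (intro integral_mono) auto
  then have close: "bernoulli_mean q ?U P \<le> bernoulli_mean p ?U P + 1 / 9"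
    unfolding P_mean using int pq by simp
  have "bernoulli_mean p ?U (\<lambda>H. of_bool (k < card H)) \<le> card ?U * p / D\<^sup>2"
    using pq D0 np by (intro bernoulli_mean_Chebyshev) auto
  \<comment> \<open>The mean is at most \<open>k\<close> here and at most \<open>2 * k\<close> for
    \<open>q\<close>, while \<open>D\<^sup>2 \<ge> 36 * k\<close>.\<close>
  also have "\<dots> \<le> 1 / 36" using np kD D0 by (simp add: field_simps)
  finally have tail_p: "bernoulli_mean p ?U (\<lambda>H. of_bool (k < card H)) \<le> 1 / 36" .
  have "bernoulli_mean q ?U (\<lambda>H. of_bool (card H < k + d)) \<le> card ?U * q / D\<^sup>2"
    using pq D0 nq assms(3) by (intro bernoulli_mean_Chebyshev) auto
  also have "\<dots> \<le> 1 / 18" using nq kD D0 assms(5) by (simp add: field_simps)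
  finally have tail_q: "bernoulli_mean q ?U (\<lambda>H. of_bool (card H < k + d)) \<le> 1 / 18" .
  have "bernoulli_mean p ?U P \<le> bernoulli_mean p ?U (\<lambda>H. 1 / 3 + of_bool (k < card H))"
  proof (rule bernoulli_mean_mono)
    fix H assume "H \<subseteq> ?U"
    then have "P H \<le> 1 / 3" if "card H \<le> k"
      unfolding P_def using that assms(6) by (intro prob_truncate_X[OF T]) auto
    then show "P H \<le> 1 / 3 + of_bool (k < card H)"
      using P01[of H] by (cases "k < card H") auto
  qed (use pq in auto)
  then have up: "bernoulli_mean p ?U P \<le> 1 / 3 + 1 / 36"
    using tail_p by (simp add: bernoulli_mean_add bernoulli_mean_const)
  have "bernoulli_mean q ?U (\<lambda>_. 2 / 3) \<le> bernoulli_mean q ?U (\<lambda>H. P H + of_bool (card H < k + d))"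
  proof (rule bernoulli_mean_mono)
    fix H assume "H \<subseteq> ?U"
    then have "2 / 3 \<le> P H" if "k + d \<le> card H"
      unfolding P_def using that by (intro prob_truncate_Y[OF T])
    then show "2 / 3 \<le> P H + of_bool (card H < k + d)"
      using P01[of H] by (cases "card H < k + d") auto
  qed (use pq in auto)
  then have "2 / 3 \<le> bernoulli_mean q ?U P + 1 / 18"
    using tail_q by (simp add: bernoulli_mean_add bernoulli_mean_const)
  \<comment> \<open>In units of \<open>1 / 36\<close>: at least 22 under \<open>q\<close>, but at
    most 13 under \<open>p\<close> plus a gap of 4.\<close>
  with up close show False by linarith
qed

section \<open>Choice of constants and universe size\<close>

theorem theorem3p4:
  "\<exists>c::real. c > 0 \<and> (\<exists>a::nat. \<forall>k d::nat. k \<ge> 1 \<longrightarrow> d \<ge> 1 \<longrightarrow>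
     (\<exists>n\<ge>k + d. real (ggt_complexity n k d) \<ge>
        c * min (real k) (1 + (real k / real d)\<^sup>2) / log 2 (real k + 1) ^ a))"
proof (intro exI conjI allI impI)
  \<comment> \<open>The product of 1000 from the lower bound and 36 from
    \<open>D\<^sup>2 = 36 * k\<close>.\<close>
  show "(0::real) < 1 / 36000" by simp
  fix k d :: nat
  assume kd: "1 \<le> k" "1 \<le> d"
  let ?n = "4 * (k + d)"
  show "k + d \<le> ?n" by simp
  have "min (real k) (1 + (real k / real d)\<^sup>2) \<le> 36000 * ggt_complexity ?n k d"
  \<comment> \<open>The threshold 144 yields \<open>6 * sqrt k \<le> k / 2\<close>; with
    \<open>2 * d \<le> k\<close> this gives \<open>D \<le> k / 2\<close>.\<close>
  proof (cases "144 \<le> k \<and> 2 * d \<le> k")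
    case True
    define D where "D = max (real d) (6 * sqrt k)"
    have "12 * sqrt k \<le> sqrt k * sqrt k"
      using True real_sqrt_le_mono[of 144 k] by (intro mult_right_mono) auto
    then have "(real k)\<^sup>2 / (1000 * D\<^sup>2) \<le> ggt_complexity ?n k d"
      using True kd by (intro ggt_complexity_lower_bound) (auto simp: D_def)
    moreover have "(real k)\<^sup>2 / (1000 * D\<^sup>2) = (real k)\<^sup>2 / D\<^sup>2 / 1000"
      by simp
    \<comment> \<open>The two values of the maximum \<open>D\<close> match the two terms of the
      minimum; in the second case \<open>1\<close> is absorbed into
      \<open>(k / d)\<^sup>2\<close>.\<close>
    moreover have "min (real k) (1 + (real k / real d)\<^sup>2) \<le> 36 * ((real k)\<^sup>2 / D\<^sup>2)"
    proof (cases "real d \<le> 6 * sqrt k")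
      case True
      then have "D\<^sup>2 = 36 * k" by (simp add: D_def power_mult_distrib)
      then show ?thesis using kd by (simp add: power2_eq_square)
    next
      case False
      then have "D = d" by (simp add: D_def)
      moreover have "1 \<le> (real k / real d)\<^sup>2"
        using True kd by (simp add: one_le_power)
      ultimately show ?thesis by (simp add: power_divide)
    qed
    ultimately show ?thesis by linarith
  next
    case False
    \<comment> \<open>Either \<open>k < 144\<close>, or \<open>k / d \<le> 2\<close> and the second
      term is at most 5; one query then suffices for the bound.\<close>
    have "min (real k) (1 + (real k / real d)\<^sup>2) \<le> 144"
    proof (cases "144 \<le> k")
      case True
      then have "real k / real d \<le> 2" using False kd by (simp add: field_simps)
      then have "(real k / real d)\<^sup>2 \<le> 2\<^sup>2" by (intro power_mono) auto
      then show ?thesis by simp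
    qed simp
    then show ?thesis using ggt_complexity_pos[OF kd(2), of k ?n] by simp
  qed
  \<comment> \<open>The exponent \<open>0\<close> is the witness for \<open>a\<close>: no logarithm
    is lost.\<close>
  then show "1 / 36000 * min (real k) (1 + (real k / real d)\<^sup>2) / log 2 (real k + 1) ^ 0
      \<le> real (ggt_complexity ?n k d)"
    by simp
qed

end
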